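(* Let $\mathbf A=(A,R)$ be a relational system, let $a\in A$, and let $\mathbf B=(A^2,S,{}^* )$ be the twist-product of $\mathbf A$. Then the following hold: (i) If $\mathbf A$ is directed then $\mathbf B$ is a directed relational system with involution $^*$. (ii) The mapping $x\mapsto(x,a)$ is an embedding of $\mathbf A$ into $(A^2,S)$.
   Context: A relational system $(A,R)$ consists of a non-empty set $A$ and a binary relation $R$ on $A$. For $a,b\in A$ let $U(a,b):=\{x\in A\mid (a,x),(b,x)\in R\}$ and $L(a,b):=\{x\in A\mid (x,a),(x,b)\in R\}$. The relational system $(A,R)$ is called directed if $U(x,y)\neq\emptyset$ and $L(x,y)\neq\emptyset$ for all $x,y\in A$. A directed relational system with involution is a triple $(A,R,{}')$ where $A$ is a non-empty set, $R$ is a reflexive binary relation on $A$, $(A,R)$ is directed, and $'$ is a unary operation on $A$ that is an involution on $(A,R)$, i.e. $x''=x$ for all $x\in A$ and $(x,y)\in R$ implies $(y',x')\in R$ for all $x,y\in A$. The twist-product of $(A,R)$ is $(A^2,S,{}^* )$ where $S:=\{((x,y),(z,v))\in(A^2)^2\mid (x,z),(v,y)\in R\}$ and $(x,y)^*:=(y,x)$ for all $(x,y)\in A^2$. An embedding of a relational system $(A,R)$ into a relational system $(B,S)$ is an injective strong homomorphism, i.e. an injective map $f:A\to B$ such that for all $x,y\in A$, $(x,y)\in R$ if and only if $(f(x),f(y))\in S$.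
   Formalization: Part (i) additionally assumes that R is reflexive, and part (ii) that (a,a) is in R; without these the claims fail, e.g. for the integers with the strict order <, where S is not reflexive and x ↦ (x,a) does not preserve R. *)

theory Defs
  imports Main
begin

definition relational_system :: "'a set \<Rightarrow> 'a rel \<Rightarrow> bool" where
  "relational_system A R \<longleftrightarrow> A \<noteq> {} \<and> R \<subseteq> A \<times> A"

definition upper_cone :: "'a set \<Rightarrow> 'a rel \<Rightarrow> 'a \<Rightarrow> 'a \<Rightarrow> 'a set" where
  "upper_cone A R a b = {x \<in> A. (a, x) \<in> R \<and> (b, x) \<in> R}"

definition lower_cone :: "'a set \<Rightarrow> 'a rel \<Rightarrow> 'a \<Rightarrow> 'a \<Rightarrow> 'a set" where
  "lower_cone A R a b = {x \<in> A. (x, a) \<in> R \<and> (x, b) \<in> R}"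

definition directed :: "'a set \<Rightarrow> 'a rel \<Rightarrow> bool" where
  "directed A R \<longleftrightarrow> relational_system A R \<and>
     (\<forall>x\<in>A. \<forall>y\<in>A. upper_cone A R x y \<noteq> {} \<and> lower_cone A R x y \<noteq> {})"

definition involution_on :: "'a set \<Rightarrow> 'a rel \<Rightarrow> ('a \<Rightarrow> 'a) \<Rightarrow> bool" where
  "involution_on A R i \<longleftrightarrow> i ` A \<subseteq> A \<and> (\<forall>x\<in>A. i (i x) = x) \<and>
     (\<forall>x\<in>A. \<forall>y\<in>A. (x, y) \<in> R \<longrightarrow> (i y, i x) \<in> R)"

definition directed_system_with_involution :: "'a set \<Rightarrow> 'a rel \<Rightarrow> ('a \<Rightarrow> 'a) \<Rightarrow> bool" where
  "directed_system_with_involution A R i \<longleftrightarrow>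
     refl_on A R \<and> directed A R \<and> involution_on A R i"

text \<open>
  The twist-product of \<open>(A, R)\<close> consists of the carrier \<open>A \<times> A\<close>, the relation
  \<open>twist_rel A R\<close>, and the unary operation \<open>twist_star\<close>. Relational systems
  need not be reflexive, but \<open>twist_rel A R\<close> is reflexive on \<open>A \<times> A\<close> only if \<open>R\<close> is
  reflexive on \<open>A\<close>, and for \<open>a \<in> A\<close> the map \<open>x \<mapsto> (x, a)\<close> can preserve a nonempty
  \<open>R\<close> only if \<open>(a, a) \<in> R\<close>.
\<close>

definition twist_rel :: "'a set \<Rightarrow> 'a rel \<Rightarrow> ('a \<times> 'a) rel" where
  "twist_rel A R = {((x, y), (z, v)) | x y z v.
     (x, y) \<in> A \<times> A \<and> (z, v) \<in> A \<times> A \<and> (x, z) \<in> R \<and> (v, y) \<in> R}"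

definition twist_star :: "'a \<times> 'a \<Rightarrow> 'a \<times> 'a" where
  "twist_star = (\<lambda>(x, y). (y, x))"

definition embedding :: "('a \<Rightarrow> 'b) \<Rightarrow> 'a set \<Rightarrow> 'a rel \<Rightarrow> 'b set \<Rightarrow> 'b rel \<Rightarrow> bool" where
  "embedding f A R B S \<longleftrightarrow> relational_system A R \<and> relational_system B S \<and>
     f ` A \<subseteq> B \<and> inj_on f A \<and>
     (\<forall>x\<in>A. \<forall>y\<in>A. (x, y) \<in> R \<longleftrightarrow> (f x, f y) \<in> S)"

end

theory Submission
  imports Defs
begin

text \<open>
  The twist relation is the product of \<open>R\<close> on the first coordinate and its converse on the
  second. Hence an upper cone in the twist-product is the product of an upper cone and a lower
  cone of \<open>(A, R)\<close> (and dually), so directedness of the twist-product uses both halves of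
  directedness of \<open>(A, R)\<close>. Exchanging the coordinates exchanges \<open>R\<close> with its converse in the
  two factors, which is why \<open>twist_star\<close> reverses the twist relation. On the slice
  \<open>A \<times> {a}\<close> the second coordinate only contributes the condition \<open>(a, a) \<in> R\<close>; once it is
  granted, the slice is a copy of \<open>(A, R)\<close>.
\<close>

lemma twist_rel_iff:
  assumes "relational_system A R"
  shows "((x, y), (z, v)) \<in> twist_rel A R \<longleftrightarrow> (x, z) \<in> R \<and> (v, y) \<in> R"
  using assms unfolding relational_system_def twist_rel_def by auto

lemma relational_system_twist:
  assumes "relational_system A R"
  shows "relational_system (A \<times> A) (twist_rel A R)"
  using assms unfolding relational_system_def twist_rel_def by auto

lemma upper_cone_twist:
  assumes "relational_system A R"
  shows "upper_cone (A \<times> A) (twist_rel A R) (x, y) (z, v) =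
           upper_cone A R x z \<times> lower_cone A R y v"
  by (auto simp: upper_cone_def lower_cone_def twist_rel_iff[OF assms])

lemma lower_cone_twist:
  assumes "relational_system A R"
  shows "lower_cone (A \<times> A) (twist_rel A R) (x, y) (z, v) =
           lower_cone A R x z \<times> upper_cone A R y v"
  by (auto simp: upper_cone_def lower_cone_def twist_rel_iff[OF assms])

lemma directed_twist:
  assumes "directed A R"
  shows "directed (A \<times> A) (twist_rel A R)"
proof -
  have rs: "relational_system A R"
    using assms by (simp add: directed_def)
  show ?thesis
    using assms
    by (auto simp: directed_def relational_system_twist[OF rs]
        upper_cone_twist[OF rs] lower_cone_twist[OF rs] Times_empty)
qed

lemma refl_on_twist:
  assumes "relational_system A R" and "refl_on A R"
  shows "refl_on (A \<times> A) (twist_rel A R)"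
  using assms(2) by (auto simp: refl_on_def twist_rel_iff[OF assms(1)])

lemma involution_on_twist_star:
  assumes "relational_system A R"
  shows "involution_on (A \<times> A) (twist_rel A R) twist_star"
  by (auto simp: involution_on_def twist_star_def twist_rel_iff[OF assms])

lemma embedding_twist:
  assumes "relational_system A R" and "(a, a) \<in> R"
  shows "embedding (\<lambda>x. (x, a)) A R (A \<times> A) (twist_rel A R)"
proof -
  have "a \<in> A"
    using assms by (auto simp: relational_system_def)
  then show ?thesis
    using assms relational_system_twist[OF assms(1)]
    by (auto simp: embedding_def inj_on_def twist_rel_iff)
qed

theorem theorem5p4:
  fixes A :: "'a set" and R :: "'a rel" and a :: 'a
  assumes "relational_system A R"
    and "a \<in> A"
  shows "(refl_on A R \<longrightarrow> directed A R \<longrightarrow>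
            directed_system_with_involution (A \<times> A) (twist_rel A R) twist_star)
       \<and> ((a, a) \<in> R \<longrightarrow>
            embedding (\<lambda>x. (x, a)) A R (A \<times> A) (twist_rel A R))"
  using assms(1)
  by (simp add: directed_system_with_involution_def refl_on_twist directed_twist
      involution_on_twist_star embedding_twist)

end
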